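(* Let $S_1,\ldots,S_k$ ($k\ge 1$) be numerical semigroups with multiplicity $m$ and let $F=\max\{\mathrm{F}(S_1),\ldots,\mathrm{F}(S_k)\}$. Let $\langle S_1,\ldots,S_k\rangle$ denote the intersection of all ratio-covarieties that contain the set $\{S_1,\ldots,S_k\}$ and have $\Delta(F,m)$ as minimum. Then $\langle S_1,\ldots,S_k\rangle$ is the least (with respect to inclusion) ratio-covariety containing $\{S_1,\ldots,S_k\}$ and having $\Delta(F,m)$ as minimum.
   Context: $\mathbb{N}$ is the set of nonnegative integers. A numerical semigroup is a submonoid $S$ of $(\mathbb{N},+)$ with $\mathbb{N}\setminus S$ finite. Its Frobenius number $\mathrm{F}(S)$ is the largest integer not in $S$, and its multiplicity is $\mathrm{m}(S)=\min(S\setminus\{0\})$. If $S\neq\mathbb{N}$, the ratio of $S$ is $\mathrm{r}(S)=\min\{s\in S\mid \mathrm{m}(S)\nmid s\}$ (equivalently, the smallest minimal generator of $S$ different from $\mathrm{m}(S)$). A ratio-covariety is a nonempty family $\mathscr{R}$ of numerical semigroups such that: 1) $\mathscr{R}$ has a minimum with respect to inclusion, denoted $\min(\mathscr{R})$; 2) if $S,T\in\mathscr{R}$ then $S\cap T\in\mathscr{R}$; 3) if $S\in\mathscr{R}$ and $S\neq\min(\mathscr{R})$, then $S\setminus\{\mathrm{r}(S)\}\in\mathscr{R}$ (in particular $\mathrm{r}(S)$ is defined, i.e. $S\neq\mathbb{N}$). $\Delta(F,m)=\langle m\rangle\cup\{n\in\mathbb{N}\mid n\ge F+1\}$, where $\langle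 m\rangle$ is the set of nonnegative multiples of $m$. *)

theory Defs
  imports Main
begin

definition numerical_semigroup :: "nat set \<Rightarrow> bool" where
  "numerical_semigroup S \<longleftrightarrow>
     0 \<in> S \<and> (\<forall>x\<in>S. \<forall>y\<in>S. x + y \<in> S) \<and> finite (UNIV - S)"

(* The largest integer not in S is taken over int, so that the Frobenius number
   of the full monoid UNIV is -1. *)
definition Frobenius_number :: "nat set \<Rightarrow> int" where
  "Frobenius_number S = (GREATEST z. z \<notin> int ` S)"

definition semigroup_multiplicity :: "nat set \<Rightarrow> nat" where
  "semigroup_multiplicity S = (LEAST s. s \<in> S - {0})"

(* Only meaningful for S \<noteq> UNIV: the multiplicity of UNIV is 1, which divides everything. *)
definition semigroup_ratio :: "nat set \<Rightarrow> nat" where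
  "semigroup_ratio S = (LEAST s. s \<in> S \<and> \<not> semigroup_multiplicity S dvd s)"

definition has_minimum :: "nat set set \<Rightarrow> bool" where
  "has_minimum R \<longleftrightarrow> (\<exists>M\<in>R. \<forall>S\<in>R. M \<subseteq> S)"

(* The order on sets is inclusion; only meaningful under has_minimum R. *)
definition family_min :: "nat set set \<Rightarrow> nat set" where
  "family_min R = (LEAST M. M \<in> R)"

(* The clause S \<noteq> UNIV in the last condition says that the ratio of S is defined. *)
definition ratio_covariety :: "nat set set \<Rightarrow> bool" where
  "ratio_covariety R \<longleftrightarrow>
     R \<noteq> {} \<and>
     (\<forall>S\<in>R. numerical_semigroup S) \<and>
     has_minimum R \<and>
     (\<forall>S\<in>R. \<forall>T\<in>R. S \<inter> T \<in> R) \<and>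
     (\<forall>S\<in>R. S \<noteq> family_min R \<longrightarrow> S \<noteq> UNIV \<and> S - {semigroup_ratio S} \<in> R)"

definition Delta :: "int \<Rightarrow> nat \<Rightarrow> nat set" where
  "Delta F m = {q * m | q. True} \<union> {n. int n \<ge> F + 1}"

definition ratio_covarieties_over :: "int \<Rightarrow> nat \<Rightarrow> nat set set \<Rightarrow> nat set set set" where
  "ratio_covarieties_over F m X =
     {R. ratio_covariety R \<and> X \<subseteq> R \<and> family_min R = Delta F m}"

definition generated_family :: "int \<Rightarrow> nat \<Rightarrow> nat set set \<Rightarrow> nat set set" where
  "generated_family F m X = \<Inter> (ratio_covarieties_over F m X)"

end

theory Submission
  imports Defs
begin

text \<open>
  The defining conditions of a ratio-covariety speak about single members or pairs of members,
  apart from the reference to the minimum. Hence they survive arbitrary nonempty intersections as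
  soon as all families involved have the same minimum (\<open>Inter_ratio_covarieties\<close>). The leastness of
  the intersection is then immediate, and the point of substance is that there is something to
  intersect: some ratio-covariety with minimum \<open>\<Delta>(F,m)\<close> contains all the given semigroups.

  Such a family is formed by all numerical semigroups of multiplicity \<open>m\<close> that contain \<open>\<Delta>(F,m)\<close>
  (\<open>ratio_covariety_oversemigroups\<close>). The ratio \<open>r\<close> of a member \<open>T\<close> can be removed because
  it is the smallest element of \<open>T\<close> that is no multiple of \<open>m\<close>: a sum of two smaller elements of
  \<open>T\<close> is a multiple of \<open>m\<close>, so \<open>r\<close> is not a sum of two nonzero elements. Moreover, if \<open>T\<close> is
  strictly larger than \<open>\<Delta>(F,m)\<close>, some element of \<open>T\<close> is no multiple of \<open>m\<close> and at most \<open>F\<close>;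
  so \<open>r \<le> F\<close>, and removing \<open>r\<close> does not touch \<open>\<Delta>(F,m)\<close>.
\<close>

section \<open>Minima of families and intersections of ratio-covarieties\<close>

lemma family_min_eqI:
  assumes "M \<in> R" "\<And>S. S \<in> R \<Longrightarrow> M \<subseteq> S"
  shows "family_min R = M"
  unfolding family_min_def using assms by (intro Least_equality) auto

lemma family_min_mem:
  assumes "has_minimum R"
  shows "family_min R \<in> R"
  using assms family_min_eqI unfolding has_minimum_def by metis

lemma family_min_subset:
  assumes "has_minimum R" "S \<in> R"
  shows "family_min R \<subseteq> S"
  using assms family_min_eqI unfolding has_minimum_def by metis

text \<open>
  The common minimum \<open>M\<close> has two effects: it lies in the intersection, which is thereby nonempty,
  and it makes the exception \<open>S \<noteq> M\<close> in the condition on ratios the same for all families.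
\<close>

lemma Inter_ratio_covarieties:
  assumes "C \<noteq> {}"
    and cov: "\<And>R. R \<in> C \<Longrightarrow> ratio_covariety R"
    and min: "\<And>R. R \<in> C \<Longrightarrow> family_min R = M"
  shows "ratio_covariety (\<Inter>C)" and "family_min (\<Inter>C) = M"
proof -
  have has_min: "has_minimum R" if "R \<in> C" for R
    using cov[OF that] by (simp add: ratio_covariety_def)
  have M_in: "M \<in> \<Inter>C"
    using family_min_mem has_min min by auto
  have M_sub: "M \<subseteq> S" if "S \<in> \<Inter>C" for S
    using family_min_subset has_min min that \<open>C \<noteq> {}\<close> by blast
  show min_eq: "family_min (\<Inter>C) = M"
    using M_in M_sub by (rule family_min_eqI)
  have "has_minimum (\<Inter>C)"
    using M_in M_sub unfolding has_minimum_def by (intro bexI ballI)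
  moreover have "numerical_semigroup S" if "S \<in> \<Inter>C" for S
  proof -
    obtain R where "R \<in> C"
      using \<open>C \<noteq> {}\<close> by blast
    then show ?thesis
      using cov[of R] that by (simp add: ratio_covariety_def)
  qed
  moreover have "S \<inter> T \<in> \<Inter>C" if "S \<in> \<Inter>C" "T \<in> \<Inter>C" for S T
  proof
    show "S \<inter> T \<in> R" if "R \<in> C" for R
      using cov[OF that] that \<open>S \<in> \<Inter>C\<close> \<open>T \<in> \<Inter>C\<close> by (simp add: ratio_covariety_def)
  qed
  moreover have "S \<noteq> UNIV \<and> S - {semigroup_ratio S} \<in> \<Inter>C" if "S \<in> \<Inter>C" "S \<noteq> M" for S
  proof -
    have "S \<noteq> UNIV \<and> S - {semigroup_ratio S} \<in> R" if "R \<in> C" for R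
      using cov[OF that] min[OF that] \<open>S \<in> \<Inter>C\<close> \<open>S \<noteq> M\<close> that
      unfolding ratio_covariety_def by auto
    then show ?thesis using \<open>C \<noteq> {}\<close> by blast
  qed
  ultimately show "ratio_covariety (\<Inter>C)"
    using M_in unfolding ratio_covariety_def min_eq by (intro conjI ballI impI) auto
qed

section \<open>Multiplicity and Frobenius number\<close>

lemma cofinite_nat_obtain_greater:
  assumes "finite (UNIV - S)"
  obtains s :: nat where "s \<in> S" "n < s"
proof -
  have "infinite S"
    using assms finite_Diff2 infinite_UNIV_nat by blast
  then obtain s where "s \<in> S" "\<not> s \<le> n"
    unfolding finite_nat_set_iff_bounded_le by blast
  then show ?thesis
    using that[of s] by simp
qed

lemma semigroup_multiplicity_mem:
  assumes "numerical_semigroup S"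
  shows "semigroup_multiplicity S \<in> S - {0}"
proof -
  have "finite (UNIV - S)"
    using assms by (simp add: numerical_semigroup_def)
  then obtain s where "s \<in> S" "0 < s"
    by (rule cofinite_nat_obtain_greater)
  then have "s \<in> S - {0}"
    by simp
  then show ?thesis
    unfolding semigroup_multiplicity_def by (rule LeastI)
qed

lemma semigroup_multiplicity_le:
  assumes "s \<in> S" "s \<noteq> 0"
  shows "semigroup_multiplicity S \<le> s"
  unfolding semigroup_multiplicity_def using assms by (intro Least_le) auto

lemma semigroup_multiplicity_eqI:
  assumes "m \<in> S" "m \<noteq> 0" "\<And>s. s \<in> S \<Longrightarrow> s \<noteq> 0 \<Longrightarrow> m \<le> s"
  shows "semigroup_multiplicity S = m"
  unfolding semigroup_multiplicity_def using assms by (intro Least_equality) auto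

lemma numerical_semigroup_multiple_mem:
  assumes "numerical_semigroup S" "x \<in> S"
  shows "q * x \<in> S"
  using assms by (induction q) (auto simp: numerical_semigroup_def)

text \<open>
  Since the Frobenius number is given as a greatest element, what needs an argument is that the
  integers outside of \<open>S\<close> are bounded from above.
\<close>

lemma mem_if_greater_Frobenius_number:
  assumes "finite (UNIV - S)" "int n > Frobenius_number S"
  shows "n \<in> S"
proof (rule ccontr)
  assume "n \<notin> S"
  obtain b where b: "\<And>x. x \<notin> S \<Longrightarrow> x \<le> b"
    using assms(1) finite_nat_set_iff_bounded_le[of "UNIV - S"] by auto
  define P where "P = (\<lambda>j. int j \<notin> int ` S)"
  have P_iff: "P j \<longleftrightarrow> j \<notin> S" for j
    by (auto simp: P_def)
  define g where "g = (GREATEST j. P j)"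
  have "P n" and P_le: "\<And>j. P j \<Longrightarrow> j \<le> b"
    using \<open>n \<notin> S\<close> b by (simp_all add: P_iff)
  then have "P g"
    unfolding g_def by (rule GreatestI_nat)
  have g_max: "j \<le> g" if "P j" for j
    unfolding g_def using that P_le by (rule Greatest_le_nat)
  have "Frobenius_number S = int g"
    unfolding Frobenius_number_def
  proof (rule Greatest_equality)
    show "int g \<notin> int ` S"
      using \<open>P g\<close> by (simp add: P_def)
    show "z \<le> int g" if "z \<notin> int ` S" for z
      using that g_max[of "nat z"] by (cases "z \<ge> 0") (auto simp: P_def)
  qed
  then show False
    using assms(2) g_max[OF \<open>P n\<close>] by simp
qed

section \<open>The semigroup \<open>\<Delta>(F,m)\<close>\<close>

lemma Delta_iff: "n \<in> Delta F m \<longleftrightarrow> m dvd n \<or> int n \<ge> F + 1"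
  by (auto simp: Delta_def dvd_def mult.commute)

lemma numerical_semigroup_Delta: "numerical_semigroup (Delta F m)"
proof -
  have "UNIV - Delta F m \<subseteq> {..nat F}"
    by (auto simp: Delta_iff)
  then have "finite (UNIV - Delta F m)"
    by (rule finite_subset) simp
  then show ?thesis
    by (auto simp: numerical_semigroup_def Delta_iff)
qed

lemma Delta_subset:
  assumes "numerical_semigroup S" "Frobenius_number S \<le> F"
  shows "Delta F (semigroup_multiplicity S) \<subseteq> S"
proof
  fix n assume "n \<in> Delta F (semigroup_multiplicity S)"
  then consider "semigroup_multiplicity S dvd n" | "int n > Frobenius_number S"
    using assms(2) by (auto simp: Delta_iff)
  then show "n \<in> S"
  proof cases
    case 1
    then obtain q where "n = q * semigroup_multiplicity S"
      by (metis dvd_def mult.commute)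
    then show ?thesis
      using numerical_semigroup_multiple_mem semigroup_multiplicity_mem assms(1) by simp
  next
    case 2
    then show ?thesis
      using assms(1) by (auto simp: numerical_semigroup_def intro: mem_if_greater_Frobenius_number)
  qed
qed

text \<open>
  For small \<open>F\<close> the multiplicity of \<open>\<Delta>(F,m)\<close> may be less than \<open>m\<close>. A semigroup of multiplicity
  \<open>m\<close> above \<open>\<Delta>(F,m)\<close> excludes this, because its nonzero elements are at least \<open>m\<close>.
\<close>

lemma semigroup_multiplicity_Delta:
  assumes "numerical_semigroup S" "Delta F (semigroup_multiplicity S) \<subseteq> S"
  shows "semigroup_multiplicity (Delta F (semigroup_multiplicity S)) = semigroup_multiplicity S"
  using assms semigroup_multiplicity_mem semigroup_multiplicity_le
  by (intro semigroup_multiplicity_eqI) (auto simp: Delta_iff)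

section \<open>Removing the ratio\<close>

lemma semigroup_ratio_le:
  assumes "s \<in> S" "\<not> semigroup_multiplicity S dvd s"
  shows "semigroup_ratio S \<le> s"
  unfolding semigroup_ratio_def using assms by (intro Least_le) auto

lemma not_multiplicity_dvd_ratio:
  assumes "\<exists>s\<in>S. \<not> semigroup_multiplicity S dvd s"
  shows "\<not> semigroup_multiplicity S dvd semigroup_ratio S"
  unfolding semigroup_ratio_def using assms by (metis (mono_tags, lifting) LeastI_ex)

text \<open>
  The ratio is a minimal generator: if \<open>x + y\<close> is the ratio and \<open>x\<close>, \<open>y\<close> are nonzero elements of
  \<open>S\<close>, then both are smaller than the ratio, so both are multiples of the multiplicity, and then the
  ratio is one too.
\<close>

lemma numerical_semigroup_remove_ratio:
  assumes "numerical_semigroup S" "\<exists>s\<in>S. \<not> semigroup_multiplicity S dvd s"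
  shows "numerical_semigroup (S - {semigroup_ratio S})"
proof -
  let ?m = "semigroup_multiplicity S" and ?r = "semigroup_ratio S"
  have r: "\<not> ?m dvd ?r"
    using assms(2) by (rule not_multiplicity_dvd_ratio)
  have "x + y \<noteq> ?r" if "x \<in> S - {?r}" "y \<in> S - {?r}" for x y
  proof
    assume sum: "x + y = ?r"
    then have "x < ?r" "y < ?r"
      using that by auto
    then have "?m dvd x" "?m dvd y"
      using semigroup_ratio_le that by (meson DiffD1 leD)+
    then show False
      using r sum by (metis dvd_add)
  qed
  moreover have "?r \<noteq> 0"
    using r by (metis dvd_0_right)
  moreover have "finite (UNIV - (S - {?r}))"
  proof (rule finite_subset)
    show "UNIV - (S - {?r}) \<subseteq> insert ?r (UNIV - S)"
      by blast
    show "finite (insert ?r (UNIV - S))"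
      using assms(1) by (simp add: numerical_semigroup_def)
  qed
  ultimately show ?thesis
    using assms(1) by (auto simp: numerical_semigroup_def)
qed

lemma semigroup_multiplicity_remove_ratio:
  assumes "numerical_semigroup S" "\<exists>s\<in>S. \<not> semigroup_multiplicity S dvd s"
  shows "semigroup_multiplicity (S - {semigroup_ratio S}) = semigroup_multiplicity S"
proof -
  have "semigroup_multiplicity S \<noteq> semigroup_ratio S"
    using not_multiplicity_dvd_ratio[OF assms(2)] by auto
  then show ?thesis
    using semigroup_multiplicity_mem[OF assms(1)] semigroup_multiplicity_le
    by (intro semigroup_multiplicity_eqI) auto
qed

section \<open>The ratio-covariety of all semigroups above \<open>\<Delta>(F,m)\<close>\<close>

definition oversemigroups :: "int \<Rightarrow> nat \<Rightarrow> nat set set" where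
  "oversemigroups F m =
     {T. numerical_semigroup T \<and> semigroup_multiplicity T = m \<and> Delta F m \<subseteq> T}"

lemma Delta_in_oversemigroups:
  assumes "oversemigroups F m \<noteq> {}"
  shows "Delta F m \<in> oversemigroups F m"
proof -
  obtain T where "numerical_semigroup T" "semigroup_multiplicity T = m" "Delta F m \<subseteq> T"
    using assms by (auto simp: oversemigroups_def)
  then show ?thesis
    using numerical_semigroup_Delta semigroup_multiplicity_Delta[of T F]
    by (simp add: oversemigroups_def)
qed

lemma family_min_oversemigroups:
  assumes "oversemigroups F m \<noteq> {}"
  shows "family_min (oversemigroups F m) = Delta F m"
  using Delta_in_oversemigroups[OF assms] by (rule family_min_eqI) (simp add: oversemigroups_def)

lemma oversemigroups_Int:
  assumes "S \<in> oversemigroups F m" "T \<in> oversemigroups F m"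
  shows "S \<inter> T \<in> oversemigroups F m"
proof -
  have ns: "numerical_semigroup S" "numerical_semigroup T"
    and mult: "semigroup_multiplicity S = m" "semigroup_multiplicity T = m"
    using assms by (auto simp: oversemigroups_def)
  have "m \<in> S \<inter> T" "m \<noteq> 0"
    using semigroup_multiplicity_mem[OF ns(1)] semigroup_multiplicity_mem[OF ns(2)] mult by auto
  then have "semigroup_multiplicity (S \<inter> T) = m"
    using mult semigroup_multiplicity_le by (intro semigroup_multiplicity_eqI) auto
  moreover have "numerical_semigroup (S \<inter> T)"
    using ns by (auto simp: numerical_semigroup_def Diff_Int)
  ultimately show ?thesis
    using assms by (auto simp: oversemigroups_def)
qed

lemma oversemigroups_remove_ratio:
  assumes "T \<in> oversemigroups F m" "T \<noteq> Delta F m"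
  shows "T \<noteq> UNIV" and "T - {semigroup_ratio T} \<in> oversemigroups F m"
proof -
  have ns: "numerical_semigroup T" and mult: "semigroup_multiplicity T = m"
    and sub: "Delta F m \<subseteq> T"
    using assms(1) by (auto simp: oversemigroups_def)
  obtain t where t: "t \<in> T" "\<not> m dvd t" "int t \<le> F"
    using sub assms(2) by (force simp: Delta_iff)
  then have nondiv: "\<exists>s\<in>T. \<not> semigroup_multiplicity T dvd s"
    using mult by blast
  show "T \<noteq> UNIV"
  proof
    assume "T = UNIV"
    then have "m \<le> 1"
      using semigroup_multiplicity_le[of 1 T] mult by simp
    moreover have "m \<noteq> 0"
      using semigroup_multiplicity_mem[OF ns] mult by auto
    ultimately have "m = 1"
      by simp
    then show False
      using t by simp
  qed
  have "semigroup_ratio T \<le> t"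
    using t mult by (intro semigroup_ratio_le) auto
  then have "semigroup_ratio T \<notin> Delta F m"
    using t not_multiplicity_dvd_ratio[OF nondiv] mult by (auto simp: Delta_iff)
  then show "T - {semigroup_ratio T} \<in> oversemigroups F m"
    using numerical_semigroup_remove_ratio[OF ns nondiv] mult sub
      semigroup_multiplicity_remove_ratio[OF ns nondiv]
    by (auto simp: oversemigroups_def)
qed

lemma ratio_covariety_oversemigroups:
  assumes "oversemigroups F m \<noteq> {}"
  shows "ratio_covariety (oversemigroups F m)"
proof -
  have "has_minimum (oversemigroups F m)"
    using Delta_in_oversemigroups[OF assms] unfolding has_minimum_def
    by (auto simp: oversemigroups_def)
  moreover have "numerical_semigroup T" if "T \<in> oversemigroups F m" for T
    using that by (simp add: oversemigroups_def)
  ultimately show ?thesis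
    using assms family_min_oversemigroups[OF assms]
    by (simp add: ratio_covariety_def oversemigroups_Int oversemigroups_remove_ratio)
qed

section \<open>The generated ratio-covariety\<close>

theorem proposition7p4:
  fixes S :: "nat \<Rightarrow> nat set" and k m :: nat and F :: int
  assumes "k \<ge> 1"
    and "\<And>i. i \<in> {1..k} \<Longrightarrow> numerical_semigroup (S i)"
    and "\<And>i. i \<in> {1..k} \<Longrightarrow> semigroup_multiplicity (S i) = m"
    and "F = Max ((\<lambda>i. Frobenius_number (S i)) ` {1..k})"
  shows "generated_family F m (S ` {1..k}) \<in> ratio_covarieties_over F m (S ` {1..k}) \<and>
    (\<forall>R \<in> ratio_covarieties_over F m (S ` {1..k}). generated_family F m (S ` {1..k}) \<subseteq> R)"
proof -
  let ?C = "ratio_covarieties_over F m (S ` {1..k})"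
  have "S i \<in> oversemigroups F m" if "i \<in> {1..k}" for i
  proof -
    have "Frobenius_number (S i) \<le> F"
      unfolding assms(4) using that by (intro Max_ge) auto
    then show ?thesis
      using Delta_subset[of "S i" F] assms(2,3)[OF that] by (simp add: oversemigroups_def)
  qed
  then have S_sub: "S ` {1..k} \<subseteq> oversemigroups F m"
    by blast
  then have "oversemigroups F m \<noteq> {}"
    using \<open>k \<ge> 1\<close> by auto
  then have "oversemigroups F m \<in> ?C"
    using S_sub ratio_covariety_oversemigroups family_min_oversemigroups
    by (simp add: ratio_covarieties_over_def)
  then have ne: "?C \<noteq> {}"
    by blast
  have cov: "ratio_covariety R" and min: "family_min R = Delta F m" if "R \<in> ?C" for R
    using that by (simp_all add: ratio_covarieties_over_def)
  have "ratio_covariety (\<Inter>?C)"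
    using ne cov min by (rule Inter_ratio_covarieties(1))
  moreover have "family_min (\<Inter>?C) = Delta F m"
    using ne cov min by (rule Inter_ratio_covarieties(2))
  moreover have "S ` {1..k} \<subseteq> \<Inter>?C"
    by (rule Inter_greatest) (simp add: ratio_covarieties_over_def)
  ultimately have "\<Inter>?C \<in> ?C"
    by (subst ratio_covarieties_over_def) simp
  then show ?thesis
    by (simp add: generated_family_def Inter_lower)
qed

end
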